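(* Let $q$ be a prime power, let $G=\mathrm{SL}(3,\mathbb{F}_q)$, and let $X$ be the $G$-set of complete flags in $\mathbb{F}_q^3$, i.e. of pairs $(p,\ell)$ consisting of a point $p$ and a line $\ell$ of the projective plane $\mathbb{F}_q\mathrm{P}^2$ with $p$ lying on $\ell$. Let $$P=\{((p,\ell),(p',\ell))\in X\times X \mid p\neq p'\},\qquad L=\{((p,\ell),(p,\ell'))\in X\times X\mid \ell\neq\ell'\},$$ regarded as spans of $G$-sets from $X$ to $X$ via the two projections to $X$. Then there is an isomorphism of spans of $G$-sets $$PLP\cong LPL.$$
   Context: A complete flag in $\mathbb{F}_q^3$ is a pair of subspaces $0\subset V_1\subset V_2\subset\mathbb{F}_q^3$ with $\dim V_1=1$, $\dim V_2=2$; $V_1$ is viewed as a point and $V_2$ as a line of $\mathbb{F}_q\mathrm{P}^2$. $G$ acts on $X$ in the natural way and on $X\times X$ diagonally. A span of $G$-sets from $X$ to $X$ is a $G$-set $S$ with two $G$-equivariant maps $S\to X$. Spans of $G$-sets are composed using the ordinary pullback of $G$-sets (fibered product over the middle copy of $X$, with the two outer maps to $X$), and $PLP$ and $LPL$ denote the resulting threefold composites. An isomorphism of spans is a $G$-equivariant bijection between their apexes commuting with both maps to $X$. *)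

theory Defs
  imports "HOL-Analysis.Determinants" "HOL-Algebra.Group_Action"
begin

section \<open>Spans of G-sets\<close>

text \<open>A G-set is a carrier together with an action in the sense of the locale
  \<^locale>\<open>group_action\<close>. That locale asks for extensional functions, hence the uses of
  \<^const>\<open>restrict\<close> below.\<close>

definition equivariant ::
  "('g, 'm) monoid_scheme \<Rightarrow> 's set \<Rightarrow> ('g \<Rightarrow> 's \<Rightarrow> 's) \<Rightarrow> 't set \<Rightarrow> ('g \<Rightarrow> 't \<Rightarrow> 't) \<Rightarrow> ('s \<Rightarrow> 't) \<Rightarrow> bool"
  where "equivariant G S \<phi> T \<psi> f \<longleftrightarrow>
    f \<in> S \<rightarrow> T \<and> (\<forall>g\<in>carrier G. \<forall>s\<in>S. f (\<phi> g s) = \<psi> g (f s))"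

record ('g, 's, 'x) gspan =
  apex :: "'s set"
  apex_action :: "'g \<Rightarrow> 's \<Rightarrow> 's"
  left_leg :: "'s \<Rightarrow> 'x"
  right_leg :: "'s \<Rightarrow> 'x"

definition is_gspan ::
  "('g, 'm) monoid_scheme \<Rightarrow> 'x set \<Rightarrow> ('g \<Rightarrow> 'x \<Rightarrow> 'x) \<Rightarrow> ('g, 's, 'x) gspan \<Rightarrow> bool"
  where "is_gspan G X \<phi> S \<longleftrightarrow>
    group_action G X \<phi> \<and>
    group_action G (apex S) (apex_action S) \<and>
    equivariant G (apex S) (apex_action S) X \<phi> (left_leg S) \<and>
    equivariant G (apex S) (apex_action S) X \<phi> (right_leg S)"

text \<open>The diagonal action on a subset of a product of two G-sets.\<close>

definition diagonal_action ::
  "('g \<Rightarrow> 's \<Rightarrow> 's) \<Rightarrow> ('g \<Rightarrow> 't \<Rightarrow> 't) \<Rightarrow> ('s \<times> 't) set \<Rightarrow> 'g \<Rightarrow> 's \<times> 't \<Rightarrow> 's \<times> 't"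
  where "diagonal_action \<phi> \<psi> R g = restrict (\<lambda>(s, t). (\<phi> g s, \<psi> g t)) R"

definition relation_gspan ::
  "('g \<Rightarrow> 'x \<Rightarrow> 'x) \<Rightarrow> ('x \<times> 'x) set \<Rightarrow> ('g, 'x \<times> 'x, 'x) gspan"
  where "relation_gspan \<phi> R =
    \<lparr>apex = R, apex_action = diagonal_action \<phi> \<phi> R, left_leg = fst, right_leg = snd\<rparr>"

definition pullback :: "('g, 's, 'x) gspan \<Rightarrow> ('g, 't, 'x) gspan \<Rightarrow> ('s \<times> 't) set"
  where "pullback S T = {(s, t). s \<in> apex S \<and> t \<in> apex T \<and> right_leg S s = left_leg T t}"

text \<open>Composites are written in the order in which the spans are traversed, first \<open>S\<close> and then
  \<open>T\<close>.\<close>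

definition gspan_comp ::
  "('g, 's, 'x) gspan \<Rightarrow> ('g, 't, 'x) gspan \<Rightarrow> ('g, 's \<times> 't, 'x) gspan"  (infixl \<open>\<Zsemi>\<close> 70)
  where "S \<Zsemi> T =
    \<lparr>apex = pullback S T,
     apex_action = diagonal_action (apex_action S) (apex_action T) (pullback S T),
     left_leg = (\<lambda>(s, t). left_leg S s),
     right_leg = (\<lambda>(s, t). right_leg T t)\<rparr>"

definition gspan_iso ::
  "('g, 'm) monoid_scheme \<Rightarrow> ('g, 's, 'x) gspan \<Rightarrow> ('g, 't, 'x) gspan \<Rightarrow> ('s \<Rightarrow> 't) \<Rightarrow> bool"
  where "gspan_iso G S T f \<longleftrightarrow>
    bij_betw f (apex S) (apex T) \<and>
    equivariant G (apex S) (apex_action S) (apex T) (apex_action T) f \<and>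
    (\<forall>s\<in>apex S. left_leg T (f s) = left_leg S s \<and> right_leg T (f s) = right_leg S s)"

definition isomorphic_gspans ::
  "('g, 'm) monoid_scheme \<Rightarrow> 'x set \<Rightarrow> ('g \<Rightarrow> 'x \<Rightarrow> 'x) \<Rightarrow>
    ('g, 's, 'x) gspan \<Rightarrow> ('g, 't, 'x) gspan \<Rightarrow> bool"
  where "isomorphic_gspans G X \<phi> S T \<longleftrightarrow>
    is_gspan G X \<phi> S \<and> is_gspan G X \<phi> T \<and> (\<exists>f. gspan_iso G S T f)"


section \<open>Complete flags in three-space and the special linear group\<close>

definition SL :: "('a::comm_ring_1 ^ 'n ^ 'n) monoid"
  where "SL = \<lparr>carrier = {A. det A = 1}, mult = (**), one = mat 1\<rparr>"

text \<open>A point and a line of the projective plane are subspaces of dimension one and two.\<close>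

type_synonym 'a flag = "('a ^ 3) set \<times> ('a ^ 3) set"

definition flags :: "'a::field flag set"
  where "flags = {(p, l). vec.subspace p \<and> vec.dim p = 1 \<and>
                          vec.subspace l \<and> vec.dim l = 2 \<and> p \<subseteq> l}"

definition flag_action :: "'a::field ^ 3 ^ 3 \<Rightarrow> 'a flag \<Rightarrow> 'a flag"
  where "flag_action A = restrict (\<lambda>(p, l). ((*v) A ` p, (*v) A ` l)) flags"

definition P_rel :: "('a::field flag \<times> 'a flag) set"
  where "P_rel = {((p, l), (p', l')). (p, l) \<in> flags \<and> (p', l') \<in> flags \<and> l = l' \<and> p \<noteq> p'}"

definition L_rel :: "('a::field flag \<times> 'a flag) set"
  where "L_rel = {((p, l), (p', l')). (p, l) \<in> flags \<and> (p', l') \<in> flags \<and> p = p' \<and> l \<noteq> l'}"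

definition P_span :: "('a::field ^ 3 ^ 3, 'a flag \<times> 'a flag, 'a flag) gspan"
  where "P_span = relation_gspan flag_action P_rel"

definition L_span :: "('a::field ^ 3 ^ 3, 'a flag \<times> 'a flag, 'a flag) gspan"
  where "L_span = relation_gspan flag_action L_rel"


section \<open>These data are G-sets and spans of G-sets\<close>

lemma group_action_restrictI:
  fixes G (structure)
  assumes G: "group G"
    and closed: "\<And>g x. g \<in> carrier G \<Longrightarrow> x \<in> E \<Longrightarrow> a g x \<in> E"
    and mult: "\<And>g h x. g \<in> carrier G \<Longrightarrow> h \<in> carrier G \<Longrightarrow> x \<in> E \<Longrightarrow> a (g \<otimes> h) x = a g (a h x)"
    and one: "\<And>x. x \<in> E \<Longrightarrow> a \<one> x = x"
  shows "group_action G E (\<lambda>g. restrict (a g) E)"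
proof -
  interpret group G by (rule G)
  have bij: "restrict (a g) E \<in> Bij E" if g: "g \<in> carrier G" for g
  proof -
    have "bij_betw (a g) E E"
    proof (rule bij_betw_byWitness[where f' = "a (inv g)"])
      show "\<forall>x\<in>E. a (inv g) (a g x) = x"
        using g mult[of "inv g" g] one by simp
      show "\<forall>x\<in>E. a g (a (inv g) x) = x"
        using g mult[of g "inv g"] one by simp
      show "a g ` E \<subseteq> E" "a (inv g) ` E \<subseteq> E" using closed g by auto
    qed
    then show ?thesis by (simp add: Bij_def)
  qed
  have "(\<lambda>g. restrict (a g) E) \<in> hom G (BijGroup E)"
  proof (rule homI)
    show "restrict (a g) E \<in> carrier (BijGroup E)" if "g \<in> carrier G" for g
      using bij[OF that] by (simp add: BijGroup_def)
    show "restrict (a (g \<otimes> h)) E = restrict (a g) E \<otimes>\<^bsub>BijGroup E\<^esub> restrict (a h) E"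
      if "g \<in> carrier G" "h \<in> carrier G" for g h
      using bij that by (auto simp: BijGroup_def compose_def closed mult fun_eq_iff)
  qed
  then show ?thesis
    unfolding group_action_def group_hom_def group_hom_axioms_def
    by (auto intro: G group_BijGroup)
qed

lemma group_action_one:
  assumes "group_action G E \<phi>" "x \<in> E"
  shows "\<phi> \<one>\<^bsub>G\<^esub> x = x"
  using group_action.id_eq_one[OF assms(1)] assms(2) by (metis restrict_apply')

lemma group_action_group: "group_action G E \<phi> \<Longrightarrow> group G"
  by (simp add: group_action_def group_hom_def)

lemma group_action_diagonal:
  assumes S: "group_action G S \<phi>" and T: "group_action G T \<psi>" and R: "R \<subseteq> S \<times> T"
    and closed: "\<And>g s t. g \<in> carrier G \<Longrightarrow> (s, t) \<in> R \<Longrightarrow> (\<phi> g s, \<psi> g t) \<in> R"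
  shows "group_action G R (diagonal_action \<phi> \<psi> R)"
proof -
  have "group_action G R (\<lambda>g. restrict (\<lambda>(s, t). (\<phi> g s, \<psi> g t)) R)"
  proof (rule group_action_restrictI[OF group_action_group[OF S]])
    fix g h x assume "g \<in> carrier G" "h \<in> carrier G" "x \<in> R"
    then show "(case x of (s, t) \<Rightarrow> (\<phi> (g \<otimes>\<^bsub>G\<^esub> h) s, \<psi> (g \<otimes>\<^bsub>G\<^esub> h) t)) =
        (case case x of (s, t) \<Rightarrow> (\<phi> h s, \<psi> h t) of (s, t) \<Rightarrow> (\<phi> g s, \<psi> g t))"
      using R group_action.composition_rule[OF S] group_action.composition_rule[OF T] by auto
  qed (use R closed group_action_one[OF S] group_action_one[OF T] in auto)
  then show ?thesis by (simp add: diagonal_action_def[abs_def])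
qed

lemma group_action_closed:
  "group_action G E \<phi> \<Longrightarrow> g \<in> carrier G \<Longrightarrow> x \<in> E \<Longrightarrow> \<phi> g x \<in> E"
  by (metis group_action.element_image)

lemma is_gspan_relation_gspan:
  assumes X: "group_action G X \<phi>" and R: "R \<subseteq> X \<times> X"
    and closed: "\<And>g x y. g \<in> carrier G \<Longrightarrow> (x, y) \<in> R \<Longrightarrow> (\<phi> g x, \<phi> g y) \<in> R"
  shows "is_gspan G X \<phi> (relation_gspan \<phi> R)"
  using group_action_diagonal[OF X X R closed] R X
  by (auto simp: is_gspan_def relation_gspan_def equivariant_def diagonal_action_def)

lemma is_gspan_comp:
  assumes S: "is_gspan G X \<phi> S" and T: "is_gspan G X \<phi> T"
  shows "is_gspan G X \<phi> (S \<Zsemi> T)"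
proof -
  have aS: "group_action G (apex S) (apex_action S)" and aT: "group_action G (apex T) (apex_action T)"
    using S T by (auto simp: is_gspan_def)
  have "group_action G (pullback S T)
      (diagonal_action (apex_action S) (apex_action T) (pullback S T))"
  proof (rule group_action_diagonal[OF aS aT])
    show "pullback S T \<subseteq> apex S \<times> apex T" by (auto simp: pullback_def)
    show "(apex_action S g s, apex_action T g t) \<in> pullback S T"
      if "g \<in> carrier G" "(s, t) \<in> pullback S T" for g s t
      using that S T group_action_closed[OF aS] group_action_closed[OF aT]
      by (auto simp: pullback_def is_gspan_def equivariant_def)
  qed
  then show ?thesis
    using S T
    by (auto simp: is_gspan_def gspan_comp_def equivariant_def diagonal_action_def pullback_def)
qed

lemma group_SL: "group (SL :: ('a::field ^ 'n ^ 'n) monoid)"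
proof (rule groupI)
  fix A :: "'a ^ 'n ^ 'n" assume "A \<in> carrier SL"
  then have A: "det A = 1" by (simp add: SL_def)
  then obtain B where "B ** A = mat 1"
    by (metis invertible_det_nz invertible_left_inverse one_neq_zero)
  moreover from this have "det B = 1" using A by (metis det_I det_mul mult.right_neutral)
  ultimately show "\<exists>B\<in>carrier SL. B \<otimes>\<^bsub>SL\<^esub> A = \<one>\<^bsub>SL\<^esub>" by (auto simp: SL_def)
qed (auto simp: SL_def det_mul matrix_mul_assoc)

lemma flag_action_closed:
  fixes A :: "'a::field ^ 3 ^ 3"
  assumes "det A = 1" and "(p, l) \<in> flags"
  shows "((*v) A ` p, (*v) A ` l) \<in> flags"
proof -
  have inj: "inj ((*v) A)"
    using assms(1) by (simp add: inj_matrix_vector_mult invertible_det_nz)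
  have "vec.dim ((*v) A ` V) = vec.dim V" for V
    by (rule vec.dim_image_eq) (auto intro: inj_on_subset[OF inj])
  then show ?thesis
    using assms(2) by (auto simp: flags_def vec.linear_subspace_image)
qed

lemma group_action_flags:
  "group_action (SL :: ('a::field ^ 3 ^ 3) monoid) flags flag_action"
proof -
  have "group_action (SL :: ('a ^ 3 ^ 3) monoid) flags
      (\<lambda>A. restrict (\<lambda>(p, l). ((*v) A ` p, (*v) A ` l)) flags)"
    by (rule group_action_restrictI[OF group_SL])
      (auto simp: SL_def flag_action_closed image_image matrix_vector_mul_assoc)
  then show ?thesis by (simp add: flag_action_def[abs_def])
qed

lemma SL_image_eq_iff:
  fixes A :: "'a::field ^ 3 ^ 3"
  assumes "A \<in> carrier SL"
  shows "(*v) A ` V = (*v) A ` W \<longleftrightarrow> V = W"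
  using assms by (simp add: SL_def inj_image_eq_iff inj_matrix_vector_mult invertible_det_nz)

lemma is_gspan_P: "is_gspan (SL :: ('a::field ^ 3 ^ 3) monoid) flags flag_action P_span"
  unfolding P_span_def
proof (rule is_gspan_relation_gspan[OF group_action_flags])
  show "P_rel \<subseteq> flags \<times> (flags :: 'a flag set)" by (auto simp: P_rel_def)
  show "(flag_action A x, flag_action A y) \<in> P_rel"
    if "A \<in> carrier SL" "(x, y) \<in> P_rel" for A and x y :: "'a flag"
    using that SL_image_eq_iff[OF that(1)]
    by (auto simp: P_rel_def flag_action_def flag_action_closed SL_def)
qed

lemma is_gspan_L: "is_gspan (SL :: ('a::field ^ 3 ^ 3) monoid) flags flag_action L_span"
  unfolding L_span_def
proof (rule is_gspan_relation_gspan[OF group_action_flags])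
  show "L_rel \<subseteq> flags \<times> (flags :: 'a flag set)" by (auto simp: L_rel_def)
  show "(flag_action A x, flag_action A y) \<in> L_rel"
    if "A \<in> carrier SL" "(x, y) \<in> L_rel" for A and x y :: "'a flag"
    using that SL_image_eq_iff[OF that(1)]
    by (auto simp: L_rel_def flag_action_def flag_action_closed SL_def)
qed

end

theory Submission
  imports Defs
begin

text \<open>An element of the apex of \<^term>\<open>P_span \<Zsemi> L_span \<Zsemi> P_span\<close> is a path of
  flags \<open>(p, l), (q, l), (q, m), (r, m)\<close>, and one of the apex of
  \<^term>\<open>L_span \<Zsemi> P_span \<Zsemi> L_span\<close> is a path \<open>(p, l), (p, n), (r, n), (r, m)\<close>, where
  consecutive flags differ. Either path goes halfway round a hexagon: the six flags of a
  nondegenerate triangle with vertices \<open>p\<close>, \<open>q\<close>, \<open>r\<close> and sides \<open>l\<close>, \<open>m\<close>, \<open>n\<close>. Either half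
  determines the other, because the side \<open>n\<close> is the line joining \<open>p\<close> and \<open>r\<close>, and the vertex \<open>q\<close> is
  the intersection of \<open>l\<close> and \<open>m\<close> (\<open>PLP_completes\<close>, \<open>LPL_completes\<close>). Hence replacing one half of
  the hexagon by the other half, which has the same end flags, is a bijection; it commutes with the
  group because linear maps preserve joins (\<open>image_join\<close>).

  The geometry rests on two dual facts: distinct points lie on exactly one common line
  (\<open>is_line_join\<close>, \<open>join_unique\<close>), and distinct lines meet in exactly one point
  (\<open>is_point_meet\<close>, \<open>meet_unique\<close>). Existence comes from the dimension formula for sums and
  intersections of subspaces, uniqueness from comparing dimensions.\<close>

section \<open>Joins and meets in the projective plane\<close>

definition is_point :: "('a::field ^ 3) set \<Rightarrow> bool"
  where "is_point p \<longleftrightarrow> vec.subspace p \<and> vec.dim p = 1"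

definition is_line :: "('a::field ^ 3) set \<Rightarrow> bool"
  where "is_line l \<longleftrightarrow> vec.subspace l \<and> vec.dim l = 2"

definition proj_join :: "('a::field ^ 3) set \<Rightarrow> ('a ^ 3) set \<Rightarrow> ('a ^ 3) set"
  where "proj_join p r = vec.span (p \<union> r)"

lemma flags_iff: "(p, l) \<in> flags \<longleftrightarrow> is_point p \<and> is_line l \<and> p \<subseteq> l"
  by (auto simp: flags_def is_point_def is_line_def)

lemma subset_join: "p \<subseteq> proj_join p r" "r \<subseteq> proj_join p r"
  using vec.span_superset[of "p \<union> r"] by (auto simp: proj_join_def)

lemma is_line_join:
  fixes p r :: "('a::field ^ 3) set"
  assumes p: "is_point p" and r: "is_point r" and ne: "p \<noteq> r"
  shows "is_line (proj_join p r)"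
proof -
  have sp: "vec.subspace p" "vec.dim p = 1" and sr: "vec.subspace r" "vec.dim r = 1"
    using p r by (auto simp: is_point_def)
  have "vec.dim (p \<inter> r) \<noteq> 1"
  proof
    assume "vec.dim (p \<inter> r) = 1"
    then have "p \<inter> r = p" "p \<inter> r = r"
      using sp sr by (simp_all add: vec.subspace_dim_equal vec.subspace_inter)
    then show False using ne by simp
  qed
  moreover have "vec.dim (p \<inter> r) \<le> 1"
    using vec.dim_subset[of "p \<inter> r" p] sp by simp
  ultimately have "vec.dim (p \<inter> r) = 0" by linarith
  moreover have "vec.dim (proj_join p r) + vec.dim (p \<inter> r) = vec.dim p + vec.dim r"
    using vec.dim_sums_Int[OF sp(1) sr(1)] sp sr
    by (simp only: proj_join_def vec.span_Un vec.span_eq_iff[THEN iffD2])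
  ultimately have "vec.dim (proj_join p r) = 2" using sp sr by linarith
  then show ?thesis by (simp add: is_line_def proj_join_def)
qed

lemma join_unique:
  fixes p r l :: "('a::field ^ 3) set"
  assumes "is_point p" "is_point r" "p \<noteq> r" and l: "is_line l" "p \<subseteq> l" "r \<subseteq> l"
  shows "l = proj_join p r"
proof -
  have "proj_join p r \<subseteq> l"
    using l by (simp add: proj_join_def is_line_def vec.span_minimal)
  then have "proj_join p r = l"
    using is_line_join[OF assms(1-3)] l by (simp add: is_line_def vec.subspace_dim_equal)
  then show ?thesis ..
qed

text \<open>Two distinct planes through the origin span three-space, so the dimension formula leaves
  dimension \<open>2 + 2 - 3 = 1\<close> for their intersection.\<close>

lemma is_point_meet:
  fixes l m :: "('a::field ^ 3) set"
  assumes l: "is_line l" and m: "is_line m" and ne: "l \<noteq> m"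
  shows "is_point (l \<inter> m)"
proof -
  have sl: "vec.subspace l" "vec.dim l = 2" and sm: "vec.subspace m" "vec.dim m = 2"
    using l m by (auto simp: is_line_def)
  have "vec.dim (l \<inter> m) \<noteq> 2"
  proof
    assume "vec.dim (l \<inter> m) = 2"
    then have "l \<inter> m = l" "l \<inter> m = m"
      using sl sm by (simp_all add: vec.subspace_dim_equal vec.subspace_inter)
    then show False using ne by simp
  qed
  moreover have "vec.dim (l \<inter> m) \<le> 2"
    using vec.dim_subset[of "l \<inter> m" l] sl by simp
  moreover have "vec.dim (proj_join l m) \<le> 3"
    using dim_subset_UNIV_cart_gen[of "proj_join l m"] by simp
  moreover have "vec.dim (proj_join l m) + vec.dim (l \<inter> m) = vec.dim l + vec.dim m"
    using vec.dim_sums_Int[OF sl(1) sm(1)] sl sm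
    by (simp only: proj_join_def vec.span_Un vec.span_eq_iff[THEN iffD2])
  ultimately have "vec.dim (l \<inter> m) = 1" using sl sm by linarith
  then show ?thesis
    using sl sm by (simp add: is_point_def vec.subspace_inter)
qed

lemma meet_unique:
  fixes l m p :: "('a::field ^ 3) set"
  assumes "is_line l" "is_line m" "l \<noteq> m" and p: "is_point p" "p \<subseteq> l" "p \<subseteq> m"
  shows "p = l \<inter> m"
  using is_point_meet[OF assms(1-3)] p by (simp add: is_point_def vec.subspace_dim_equal)

lemma image_join:
  fixes A :: "'a::field ^ 3 ^ 3"
  shows "(*v) A ` proj_join p r = proj_join ((*v) A ` p) ((*v) A ` r)"
  by (simp only: proj_join_def image_Un[symmetric] vec.linear_span_image[OF matrix_vector_mul_linear_gen])

section \<open>The two halves of the hexagon\<close>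

type_synonym 'a path = "(('a flag \<times> 'a flag) \<times> ('a flag \<times> 'a flag)) \<times> ('a flag \<times> 'a flag)"

fun PLP_path :: "'a::field flag \<Rightarrow> ('a ^ 3) set \<Rightarrow> 'a flag \<Rightarrow> 'a path"
  where "PLP_path (p, l) q (r, m) =
    ((((p, l), (q, l)), ((q, l), (q, m))), ((q, m), (r, m)))"

fun LPL_path :: "'a::field flag \<Rightarrow> ('a ^ 3) set \<Rightarrow> 'a flag \<Rightarrow> 'a path"
  where "LPL_path (p, l) n (r, m) =
    ((((p, l), (p, n)), ((p, n), (r, n))), ((r, n), (r, m)))"

lemmas span_simps = gspan_comp_def pullback_def P_span_def L_span_def relation_gspan_def

lemma PLP_path_mem:
  "PLP_path (p, l) q (r, m) \<in> apex (P_span \<Zsemi> L_span \<Zsemi> P_span) \<longleftrightarrow>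
    (p, l) \<in> flags \<and> (q, l) \<in> flags \<and> (q, m) \<in> flags \<and> (r, m) \<in> flags \<and>
    p \<noteq> q \<and> l \<noteq> m \<and> q \<noteq> r"
  by (auto simp: span_simps P_rel_def L_rel_def)

lemma LPL_path_mem:
  "LPL_path (p, l) n (r, m) \<in> apex (L_span \<Zsemi> P_span \<Zsemi> L_span) \<longleftrightarrow>
    (p, l) \<in> flags \<and> (p, n) \<in> flags \<and> (r, n) \<in> flags \<and> (r, m) \<in> flags \<and>
    l \<noteq> n \<and> p \<noteq> r \<and> n \<noteq> m"
  by (auto simp: span_simps P_rel_def L_rel_def)

lemma PLP_pathE:
  assumes "s \<in> apex (P_span \<Zsemi> L_span \<Zsemi> P_span)"
  obtains p l q r m where "s = PLP_path (p, l) q (r, m)"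
  using assms by (auto simp: span_simps P_rel_def L_rel_def)

lemma LPL_pathE:
  assumes "s \<in> apex (L_span \<Zsemi> P_span \<Zsemi> L_span)"
  obtains p l n r m where "s = LPL_path (p, l) n (r, m)"
  using assms by (auto simp: span_simps P_rel_def L_rel_def)

lemma action_PLP_path:
  assumes "PLP_path (p, l) q (r, m) \<in> apex (P_span \<Zsemi> L_span \<Zsemi> P_span)"
  shows "apex_action (P_span \<Zsemi> L_span \<Zsemi> P_span) A (PLP_path (p, l) q (r, m)) =
    PLP_path ((*v) A ` p, (*v) A ` l) ((*v) A ` q) ((*v) A ` r, (*v) A ` m)"
  using assms
  by (auto simp: span_simps diagonal_action_def flag_action_def P_rel_def L_rel_def)

lemma action_LPL_path:
  assumes "LPL_path (p, l) n (r, m) \<in> apex (L_span \<Zsemi> P_span \<Zsemi> L_span)"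
  shows "apex_action (L_span \<Zsemi> P_span \<Zsemi> L_span) A (LPL_path (p, l) n (r, m)) =
    LPL_path ((*v) A ` p, (*v) A ` l) ((*v) A ` n) ((*v) A ` r, (*v) A ` m)"
  using assms
  by (auto simp: span_simps diagonal_action_def flag_action_def P_rel_def L_rel_def)

fun PLP_to_LPL :: "'a::field path \<Rightarrow> 'a path"
  where "PLP_to_LPL (((((p, l), _), _), (_, (r, m)))) = LPL_path (p, l) (proj_join p r) (r, m)"

fun LPL_to_PLP :: "'a::field path \<Rightarrow> 'a path"
  where "LPL_to_PLP (((((p, l), _), _), (_, (r, m)))) = PLP_path (p, l) (l \<inter> m) (r, m)"

text \<open>Nondegeneracy is needed before the third side can be drawn: if \<open>r\<close> lay on \<open>l\<close>, then \<open>l\<close> and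
  \<open>m\<close> would share both \<open>q\<close> and \<open>r\<close> and so coincide; if \<open>p\<close> lay on \<open>m\<close>, they
  would share both \<open>p\<close> and \<open>q\<close>. So \<open>p\<close> and \<open>r\<close> are distinct and their join is neither \<open>l\<close> nor \<open>m\<close>.\<close>

lemma PLP_completes:
  assumes "(p, l) \<in> flags" "(q, l) \<in> flags" "(q, m) \<in> flags" "(r, m) \<in> flags"
    and "p \<noteq> q" "l \<noteq> m" "q \<noteq> r"
  shows "(p, proj_join p r) \<in> flags" "(r, proj_join p r) \<in> flags" "l \<noteq> proj_join p r" "p \<noteq> r"
    "proj_join p r \<noteq> m" "l \<inter> m = q"
proof -
  note f = assms(1-4)[unfolded flags_iff]
  have r: "\<not> r \<subseteq> l"
    using join_unique[of q r l] join_unique[of q r m] f assms(5-7) by blast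
  have p: "\<not> p \<subseteq> m"
    using join_unique[of p q l] join_unique[of p q m] f assms(5-7) by blast
  show "p \<noteq> r" using f p by blast
  then have "is_line (proj_join p r)" using f is_line_join by blast
  then show "(p, proj_join p r) \<in> flags" "(r, proj_join p r) \<in> flags"
    using f by (simp_all add: flags_iff subset_join)
  show "l \<noteq> proj_join p r" "proj_join p r \<noteq> m"
    using r p subset_join[where p = p and r = r] by blast+
  show "l \<inter> m = q" using meet_unique[of l m q] f assms(6) by simp
qed

text \<open>The projective dual of \<open>PLP_completes\<close>: if \<open>l\<close> and \<open>m\<close> coincided, or
  if \<open>l \<inter> m\<close> were \<open>p\<close> or \<open>r\<close>, then \<open>n\<close> and another side would share both \<open>p\<close> and \<open>r\<close>.\<close>

lemma LPL_completes:
  assumes "(p, l) \<in> flags" "(p, n) \<in> flags" "(r, n) \<in> flags" "(r, m) \<in> flags"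
    and "l \<noteq> n" "p \<noteq> r" "n \<noteq> m"
  shows "(l \<inter> m, l) \<in> flags" "(l \<inter> m, m) \<in> flags" "p \<noteq> l \<inter> m" "l \<noteq> m"
    "l \<inter> m \<noteq> r" "proj_join p r = n"
proof -
  note f = assms(1-4)[unfolded flags_iff]
  show n: "proj_join p r = n" using join_unique[of p r n] f assms(6) by simp
  have r: "\<not> r \<subseteq> l" and p: "\<not> p \<subseteq> m"
    using join_unique[of p r l] join_unique[of p r m] f assms(5-7) n by blast+
  show "l \<noteq> m" using f r by blast
  then have "is_point (l \<inter> m)" using f is_point_meet by blast
  then show "(l \<inter> m, l) \<in> flags" "(l \<inter> m, m) \<in> flags" using f by (auto simp: flags_iff)
  show "p \<noteq> l \<inter> m" "l \<inter> m \<noteq> r" using r p by blast+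
qed

lemma PLP_to_LPL_on_apex:
  assumes "s \<in> apex (P_span \<Zsemi> L_span \<Zsemi> P_span)"
  shows "PLP_to_LPL s \<in> apex (L_span \<Zsemi> P_span \<Zsemi> L_span)"
    and "LPL_to_PLP (PLP_to_LPL s) = s"
proof -
  obtain p l q r m where s: "s = PLP_path (p, l) q (r, m)"
    using assms by (rule PLP_pathE)
  note c = assms[unfolded s PLP_path_mem]
  have "LPL_path (p, l) (proj_join p r) (r, m) \<in> apex (L_span \<Zsemi> P_span \<Zsemi> L_span)"
    unfolding LPL_path_mem using c PLP_completes[of p l q m r] by simp
  then show "PLP_to_LPL s \<in> apex (L_span \<Zsemi> P_span \<Zsemi> L_span)" by (simp add: s)
  show "LPL_to_PLP (PLP_to_LPL s) = s" using c PLP_completes(6)[of p l q m r] by (simp add: s)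
qed

lemma LPL_to_PLP_on_apex:
  assumes "s \<in> apex (L_span \<Zsemi> P_span \<Zsemi> L_span)"
  shows "LPL_to_PLP s \<in> apex (P_span \<Zsemi> L_span \<Zsemi> P_span)"
    and "PLP_to_LPL (LPL_to_PLP s) = s"
proof -
  obtain p l n r m where s: "s = LPL_path (p, l) n (r, m)"
    using assms by (rule LPL_pathE)
  note c = assms[unfolded s LPL_path_mem]
  have "PLP_path (p, l) (l \<inter> m) (r, m) \<in> apex (P_span \<Zsemi> L_span \<Zsemi> P_span)"
    unfolding PLP_path_mem using c LPL_completes[of p l n r m] by simp
  then show "LPL_to_PLP s \<in> apex (P_span \<Zsemi> L_span \<Zsemi> P_span)" by (simp add: s)
  show "PLP_to_LPL (LPL_to_PLP s) = s" using c LPL_completes(6)[of p l n r m] by (simp add: s)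
qed

lemma PLP_to_LPL_equivariant:
  assumes s: "s \<in> apex (P_span \<Zsemi> L_span \<Zsemi> P_span)"
  shows "PLP_to_LPL (apex_action (P_span \<Zsemi> L_span \<Zsemi> P_span) A s) =
    apex_action (L_span \<Zsemi> P_span \<Zsemi> L_span) A (PLP_to_LPL s)"
proof -
  obtain p l q r m where eq: "s = PLP_path (p, l) q (r, m)"
    using s by (rule PLP_pathE)
  have "LPL_path (p, l) (proj_join p r) (r, m) \<in> apex (L_span \<Zsemi> P_span \<Zsemi> L_span)"
    using PLP_to_LPL_on_apex(1)[OF s] by (simp add: eq)
  from action_LPL_path[OF this, of A] action_PLP_path[OF s[unfolded eq], of A]
  show ?thesis by (simp add: eq image_join)
qed

theorem mainTheorem5:
  shows "isomorphic_gspans (SL :: ('a::{field,finite} ^ 3 ^ 3) monoid) flags flag_action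
    (P_span \<Zsemi> L_span \<Zsemi> P_span) (L_span \<Zsemi> P_span \<Zsemi> L_span)"
proof -
  let ?PLP = "P_span \<Zsemi> L_span \<Zsemi> P_span :: ('a ^ 3 ^ 3, 'a path, 'a flag) gspan"
  let ?LPL = "L_span \<Zsemi> P_span \<Zsemi> L_span :: ('a ^ 3 ^ 3, 'a path, 'a flag) gspan"
  have "bij_betw PLP_to_LPL (apex ?PLP) (apex ?LPL)"
    by (rule bij_betw_byWitness[where f' = LPL_to_PLP])
      (use PLP_to_LPL_on_apex LPL_to_PLP_on_apex in blast)+
  moreover have "equivariant SL (apex ?PLP) (apex_action ?PLP) (apex ?LPL) (apex_action ?LPL) PLP_to_LPL"
    unfolding equivariant_def using PLP_to_LPL_on_apex(1) PLP_to_LPL_equivariant by blast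
  moreover have "left_leg ?LPL (PLP_to_LPL s) = left_leg ?PLP s \<and>
      right_leg ?LPL (PLP_to_LPL s) = right_leg ?PLP s" if "s \<in> apex ?PLP" for s
    using that by (rule PLP_pathE) (simp add: span_simps)
  ultimately have "gspan_iso SL ?PLP ?LPL PLP_to_LPL"
    by (simp add: gspan_iso_def)
  then show ?thesis
    unfolding isomorphic_gspans_def
    by (blast intro: is_gspan_comp is_gspan_P is_gspan_L)
qed

end
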